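(* Let $d \geq 2$ and $m \geq 1$ be integers, and let $l \geq 0$. (i) The $\mathsf{FI}\#$-$\mathbb{Q}$-module $\mathcal{G}^{d,m,l}$ has weight $\leq \frac{m+2}{m+d}\,l$. (ii) The $\mathsf{FI}\#$-$\mathbb{Q}$-module $\mathcal{L}^{d,m,l}$ has weight $\leq \frac{m+2}{m+d}\,l$.
   Context: $\mathsf{FI}\#$ is the category whose objects are finite sets and whose morphisms $S \to T$ are triples $(A,B,\phi)$ with $A \subset S$, $B \subset T$ and $\phi : A \to B$ a bijection; composition is composition of functions with the largest possible domain and codomain making the composite a well-defined bijection. An $\mathsf{FI}\#$-$\mathbb{Q}$-module is a functor $F$ from $\mathsf{FI}\#$ to $\mathbb{Q}$-vector spaces; its value $F_n$ on $[n]=\{1,\ldots,n\}$ is a representation of $\mathfrak{S}_n$. $\mathcal{G}^{d,m}$ is the functor sending a finite set to the (graded) dual of the free graded rational Gerstenhaber algebra on that set, where the generators have degree $d$ and the Gerstenhaber bracket has degree $m-1$ (a degree $0$ graded-commutative product together with a degree $m-1$ bracket; for $m=1$ the free such algebra is isomorphic as a graded vector space to the free associative algebra). $\mathcal{L}^{d,m}$ is the functor sending a finite set to the free graded rational Lie algebra on that set with generators of degree $d$ and bracket of degree $m-1$. $\mathcal{G}^{d,m,l}$ and $\mathcal{L}^{d,m,l}$ denote their degree-$l$ graded pieces. The $\mathfrak{S}_n$-actions permute the generators. Weight: for a partition $\lambda = (\lambda_1 \geq \cdots \geq \lambda_r > 0)$ of $|\lambda|$ and $n \geq |\lambda|+\lambda_1$,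 let $V(\lambda)_n$ be the irreducible rational representation of $\mathfrak{S}_n$ corresponding to the partition $(n-|\lambda| \geq \lambda_1 \geq \cdots \geq \lambda_r>0)$ of $n$. $F$ has weight $\leq s$ if for every $n \geq 0$ and every irreducible constituent $V(\lambda)_n$ of $F_n$ one has $|\lambda| \leq s$. *)

theory Defs
  imports
    "HOL-Library.Poly_Mapping"
    "HOL-Combinatorics.Permutations"
    "Jordan_Normal_Form.VS_Connect"
begin

section \<open>Rational vector spaces\<close>

abbreviation rat_vectorspace :: "(rat, 'v) module \<Rightarrow> bool"
  where "rat_vectorspace V \<equiv> vectorspace class_ring V"

abbreviation rat_linear :: "(rat, 'v) module \<Rightarrow> (rat, 'w) module \<Rightarrow> ('v \<Rightarrow> 'w) \<Rightarrow> bool"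
  where "rat_linear V W h \<equiv> linear_map class_ring V W h"

text \<open>The type \<^typ>\<open>'k \<Rightarrow>\<^sub>0 rat\<close> is the rational vector space with basis \<^typ>\<open>'k\<close>;
  the basis vector of \<open>k\<close> is \<open>Poly_Mapping.single k 1\<close>.
  The fields \<open>mult\<close> and \<open>one\<close> of module records play no role.\<close>

definition pm_scale :: "rat \<Rightarrow> ('k \<Rightarrow>\<^sub>0 rat) \<Rightarrow> ('k \<Rightarrow>\<^sub>0 rat)"
  where "pm_scale c v = Poly_Mapping.map ((*) c) v"

lemma lookup_pm_scale [simp]: "Poly_Mapping.lookup (pm_scale c v) k = c * Poly_Mapping.lookup v k"
  unfolding pm_scale_def by transfer (simp add: when_def)

interpretation pm: Vector_Spaces.vector_space
  "pm_scale :: rat \<Rightarrow> ('k \<Rightarrow>\<^sub>0 rat) \<Rightarrow> ('k \<Rightarrow>\<^sub>0 rat)"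
  by unfold_locales (auto intro!: poly_mapping_eqI simp: lookup_add algebra_simps)

definition pm_on :: "'k set \<Rightarrow> ('k \<Rightarrow>\<^sub>0 rat) set"
  where "pm_on B = {v. Poly_Mapping.keys v \<subseteq> B}"

definition pm_vs :: "('k \<Rightarrow>\<^sub>0 rat) set \<Rightarrow> (rat, 'k \<Rightarrow>\<^sub>0 rat) module"
  where "pm_vs W =
    \<lparr>carrier = W, mult = undefined, one = undefined, zero = 0, add = (+), smult = pm_scale\<rparr>"

definition lin_ext :: "('k \<Rightarrow> ('l \<Rightarrow>\<^sub>0 rat)) \<Rightarrow> ('k \<Rightarrow>\<^sub>0 rat) \<Rightarrow> ('l \<Rightarrow>\<^sub>0 rat)"
  where "lin_ext f v = (\<Sum>k\<in>Poly_Mapping.keys v. pm_scale (Poly_Mapping.lookup v k) (f k))"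

definition bilin_ext ::
  "('k \<Rightarrow> 'k \<Rightarrow> 'k) \<Rightarrow> ('k \<Rightarrow>\<^sub>0 rat) \<Rightarrow> ('k \<Rightarrow>\<^sub>0 rat) \<Rightarrow> ('k \<Rightarrow>\<^sub>0 rat)"
  where "bilin_ext op v w =
    lin_ext (\<lambda>a. lin_ext (\<lambda>b. Poly_Mapping.single (op a b) 1) w) v"

definition pm_coset :: "('k \<Rightarrow>\<^sub>0 rat) set \<Rightarrow> ('k \<Rightarrow>\<^sub>0 rat) \<Rightarrow> ('k \<Rightarrow>\<^sub>0 rat) set"
  where "pm_coset I x = {x + i | i. i \<in> I}"

text \<open>The image of the subspace \<open>W\<close> in the quotient by the subspace \<open>I\<close>, that is
  \<open>(W + I) / I\<close>; \<open>W\<close> need not contain \<open>I\<close>.\<close>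

definition quot_vs ::
  "('k \<Rightarrow>\<^sub>0 rat) set \<Rightarrow> ('k \<Rightarrow>\<^sub>0 rat) set \<Rightarrow> (rat, ('k \<Rightarrow>\<^sub>0 rat) set) module"
  where "quot_vs W I =
    \<lparr>carrier = pm_coset I ` W, mult = undefined, one = undefined, zero = I,
     add = (\<lambda>X Y. {x + y | x y. x \<in> X \<and> y \<in> Y}),
     smult = (\<lambda>c X. {pm_scale c x + i | x i. x \<in> X \<and> i \<in> I})\<rparr>"

definition rat_line :: "(rat, rat) module"
  where "rat_line =
    \<lparr>carrier = UNIV, mult = (*), one = 1, zero = 0, add = (+), smult = (*)\<rparr>"

definition dual_vs :: "(rat, 'v) module \<Rightarrow> (rat, 'v \<Rightarrow> rat) module"
  where "dual_vs V =
    \<lparr>carrier = LinearCombinations.module_hom class_ring V rat_line \<inter> extensional (carrier V),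
     mult = undefined, one = undefined, zero = (\<lambda>x\<in>carrier V. 0),
     add = (\<lambda>f g. \<lambda>x\<in>carrier V. f x + g x),
     smult = (\<lambda>c f. \<lambda>x\<in>carrier V. c * f x)\<rparr>"


section \<open>FI\#-modules\<close>

text \<open>Objects are finite sets of natural numbers. Every finite set is in bijection with one of
  these, so this full subcategory is equivalent to the whole of \<open>FI#\<close>; it contains
  \<open>[n] = {1..n}\<close>. The map of a morphism is kept extensional, so that equality of triples is
  equality of morphisms.\<close>

type_synonym fi_mor = "nat set \<times> nat set \<times> (nat \<Rightarrow> nat)"

definition fi_hom :: "nat set \<Rightarrow> nat set \<Rightarrow> fi_mor set"
  where "fi_hom S T = {(A, B, \<phi>). A \<subseteq> S \<and> B \<subseteq> T \<and> bij_betw \<phi> A B \<and> \<phi> \<in> extensional A}"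

definition fi_id :: "nat set \<Rightarrow> fi_mor"
  where "fi_id S = (S, S, \<lambda>x\<in>S. x)"

text \<open>\<open>fi_comp g f\<close> is \<open>g\<close> after \<open>f\<close>.\<close>

fun fi_comp :: "fi_mor \<Rightarrow> fi_mor \<Rightarrow> fi_mor"
  where "fi_comp (A', B', \<psi>) (A, B, \<phi>) =
    (let D = {x \<in> A. \<phi> x \<in> A'} in (D, \<psi> ` \<phi> ` D, \<lambda>x\<in>D. \<psi> (\<phi> x)))"

fun fi_inverse :: "fi_mor \<Rightarrow> fi_mor"
  where "fi_inverse (A, B, \<phi>) = (B, A, \<lambda>y\<in>B. inv_into A \<phi> y)"

record 'v fi_data =
  fi_obj :: "nat set \<Rightarrow> (rat, 'v) module"
  fi_map :: "nat set \<Rightarrow> nat set \<Rightarrow> fi_mor \<Rightarrow> 'v \<Rightarrow> 'v"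

definition fi_sharp_module :: "'v fi_data \<Rightarrow> bool"
  where "fi_sharp_module F \<longleftrightarrow>
    (\<forall>S. finite S \<longrightarrow> rat_vectorspace (fi_obj F S)) \<and>
    (\<forall>S T. finite S \<longrightarrow> finite T \<longrightarrow>
      (\<forall>f\<in>fi_hom S T. rat_linear (fi_obj F S) (fi_obj F T) (fi_map F S T f))) \<and>
    (\<forall>S. finite S \<longrightarrow> (\<forall>x\<in>carrier (fi_obj F S). fi_map F S S (fi_id S) x = x)) \<and>
    (\<forall>S T U. finite S \<longrightarrow> finite T \<longrightarrow> finite U \<longrightarrow>
      (\<forall>f\<in>fi_hom S T. \<forall>g\<in>fi_hom T U. \<forall>x\<in>carrier (fi_obj F S).
        fi_map F S U (fi_comp g f) x = fi_map F T U g (fi_map F S T f x)))"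

text \<open>Pointwise dual; contravariance is undone by the isomorphism of \<open>FI#\<close> with its opposite
  category which inverts the partial bijections.\<close>

definition dual_fi :: "'v fi_data \<Rightarrow> ('v \<Rightarrow> rat) fi_data"
  where "dual_fi F =
    \<lparr>fi_obj = (\<lambda>S. dual_vs (fi_obj F S)),
     fi_map = (\<lambda>S T f g. \<lambda>x\<in>carrier (fi_obj F T). g (fi_map F T S (fi_inverse f) x))\<rparr>"

definition sym_action :: "'v fi_data \<Rightarrow> nat \<Rightarrow> (nat \<Rightarrow> nat) \<Rightarrow> 'v \<Rightarrow> 'v"
  where "sym_action F n \<sigma> = fi_map F {1..n} {1..n} ({1..n}, {1..n}, restrict \<sigma> {1..n})"


section \<open>Specht modules and weight\<close>

definition is_partition :: "nat list \<Rightarrow> bool"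
  where "is_partition \<nu> \<longleftrightarrow> sorted_wrt (\<ge>) \<nu> \<and> 0 \<notin> set \<nu>"

definition first_part :: "nat list \<Rightarrow> nat"
  where "first_part \<nu> = (case \<nu> of [] \<Rightarrow> 0 | a # _ \<Rightarrow> a)"

definition diagram :: "nat list \<Rightarrow> (nat \<times> nat) set"
  where "diagram \<mu> = {(i, j). i < length \<mu> \<and> j < \<mu> ! i}"

definition tableau :: "nat list \<Rightarrow> (nat \<times> nat \<Rightarrow> nat) \<Rightarrow> bool"
  where "tableau \<mu> t \<longleftrightarrow> bij_betw t (diagram \<mu>) {1..sum_list \<mu>}"

text \<open>A tabloid is represented by the list of its rows, each row being a set.\<close>

definition tabloid :: "nat list \<Rightarrow> (nat \<times> nat \<Rightarrow> nat) \<Rightarrow> nat set list"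
  where "tabloid \<mu> t = map (\<lambda>i. {t (i, j) | j. j < \<mu> ! i}) [0..<length \<mu>]"

definition column :: "nat list \<Rightarrow> (nat \<times> nat \<Rightarrow> nat) \<Rightarrow> nat \<Rightarrow> nat set"
  where "column \<mu> t j = {t (i, j) | i. (i, j) \<in> diagram \<mu>}"

definition column_stabilizer :: "nat list \<Rightarrow> (nat \<times> nat \<Rightarrow> nat) \<Rightarrow> (nat \<Rightarrow> nat) set"
  where "column_stabilizer \<mu> t =
    {\<sigma>. \<sigma> permutes {1..sum_list \<mu>} \<and> (\<forall>j. \<sigma> ` column \<mu> t j = column \<mu> t j)}"

definition polytabloid :: "nat list \<Rightarrow> (nat \<times> nat \<Rightarrow> nat) \<Rightarrow> (nat set list \<Rightarrow>\<^sub>0 rat)"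
  where "polytabloid \<mu> t =
    (\<Sum>\<sigma>\<in>column_stabilizer \<mu> t.
      Poly_Mapping.single (map ((`) \<sigma>) (tabloid \<mu> t)) (of_int (sign \<sigma>)))"

definition specht :: "nat list \<Rightarrow> (rat, nat set list \<Rightarrow>\<^sub>0 rat) module"
  where "specht \<mu> = pm_vs (pm.span {polytabloid \<mu> t | t. tableau \<mu> t})"

definition specht_action ::
  "(nat \<Rightarrow> nat) \<Rightarrow> (nat set list \<Rightarrow>\<^sub>0 rat) \<Rightarrow> (nat set list \<Rightarrow>\<^sub>0 rat)"
  where "specht_action \<sigma> = lin_ext (\<lambda>T. Poly_Mapping.single (map ((`) \<sigma>) T) 1)"

text \<open>\<open>(V, \<rho>)\<close> is isomorphic to a subrepresentation of the representation \<open>(W, \<tau>)\<close> of the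
  symmetric group on \<open>{1..n}\<close>. Rational representations of finite groups are semisimple, so for
  irreducible \<open>V\<close> this says that \<open>V\<close> is a constituent of \<open>W\<close>.\<close>

definition constituent ::
  "nat \<Rightarrow> (rat, 'v) module \<Rightarrow> ((nat \<Rightarrow> nat) \<Rightarrow> 'v \<Rightarrow> 'v) \<Rightarrow>
   (rat, 'w) module \<Rightarrow> ((nat \<Rightarrow> nat) \<Rightarrow> 'w \<Rightarrow> 'w) \<Rightarrow> bool"
  where "constituent n V \<rho> W \<tau> \<longleftrightarrow>
    (\<exists>h. rat_linear V W h \<and> inj_on h (carrier V) \<and>
      (\<forall>\<sigma>. \<sigma> permutes {1..n} \<longrightarrow> (\<forall>v\<in>carrier V. h (\<rho> \<sigma> v) = \<tau> \<sigma> (h v))))"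

text \<open>\<open>V(\<nu>)\<^sub>n\<close> is the Specht module of \<open>(n - |\<nu>|, \<nu>\<^sub>1, \<dots>, \<nu>\<^sub>r)\<close>. The only case in which this
  list has a zero entry is \<open>n = 0\<close>, where the shape \<open>[0]\<close> gives the trivial representation.\<close>

definition weight_le :: "'v fi_data \<Rightarrow> real \<Rightarrow> bool"
  where "weight_le F s \<longleftrightarrow>
    (\<forall>n \<nu>. is_partition \<nu> \<longrightarrow> sum_list \<nu> + first_part \<nu> \<le> n \<longrightarrow>
      constituent n (specht ((n - sum_list \<nu>) # \<nu>)) specht_action
        (fi_obj F {1..n}) (sym_action F n) \<longrightarrow>
      real (sum_list \<nu>) \<le> s)"


section \<open>Free algebras\<close>

text \<open>The two-sided ideal generated by the relators \<open>R\<close> in the free nonassociative algebra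
  with basis of monomials \<open>M\<close> and with the bilinear operations \<open>ops\<close>.\<close>

inductive_set gen_ideal ::
  "('k \<Rightarrow> 'k \<Rightarrow> 'k) set \<Rightarrow> 'k set \<Rightarrow> ('k \<Rightarrow>\<^sub>0 rat) set \<Rightarrow> ('k \<Rightarrow>\<^sub>0 rat) set"
  for ops M R where
  rel: "x \<in> R \<Longrightarrow> x \<in> gen_ideal ops M R"
| zero: "0 \<in> gen_ideal ops M R"
| add: "x \<in> gen_ideal ops M R \<Longrightarrow> y \<in> gen_ideal ops M R \<Longrightarrow> x + y \<in> gen_ideal ops M R"
| scale: "x \<in> gen_ideal ops M R \<Longrightarrow> pm_scale c x \<in> gen_ideal ops M R"
| left: "x \<in> gen_ideal ops M R \<Longrightarrow> op \<in> ops \<Longrightarrow> y \<in> pm_on M \<Longrightarrow>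
    bilin_ext op y x \<in> gen_ideal ops M R"
| right: "x \<in> gen_ideal ops M R \<Longrightarrow> op \<in> ops \<Longrightarrow> y \<in> pm_on M \<Longrightarrow>
    bilin_ext op x y \<in> gen_ideal ops M R"

text \<open>The degree \<open>l\<close> piece of the functor taking \<open>S\<close> to the quotient by \<open>I S\<close> of the free
  nonassociative algebra on \<open>S\<close>. Here \<open>letters t\<close> is the set of generators
  occurring in the monomial \<open>t\<close> and \<open>rename \<phi>\<close> renames them. A morphism \<open>(A, B, \<phi>)\<close> acts as the
  algebra homomorphism sending a generator \<open>s\<close> to \<open>\<phi> s\<close> if \<open>s \<in> A\<close> and to \<open>0\<close> otherwise.\<close>

definition free_alg_piece ::
  "('k \<Rightarrow> nat set) \<Rightarrow> ((nat \<Rightarrow> nat) \<Rightarrow> 'k \<Rightarrow> 'k) \<Rightarrow> ('k \<Rightarrow> nat) \<Rightarrow>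
   (nat set \<Rightarrow> ('k \<Rightarrow>\<^sub>0 rat) set) \<Rightarrow> nat \<Rightarrow> ('k \<Rightarrow>\<^sub>0 rat) set fi_data"
  where "free_alg_piece letters rename dg I l =
    \<lparr>fi_obj = (\<lambda>S. quot_vs (pm_on {t. letters t \<subseteq> S \<and> dg t = l}) (I S)),
     fi_map = (\<lambda>S T (A, B, \<phi>) X.
       \<Union>x\<in>X. pm_coset (I T)
         (lin_ext (\<lambda>t. if letters t \<subseteq> A then Poly_Mapping.single (rename \<phi> t) 1 else 0) x))\<rparr>"

definition gsign :: "nat \<Rightarrow> rat"
  where "gsign k = (-1) ^ k"

subsection \<open>Graded Lie algebras with bracket of degree \<open>m - 1\<close>\<close>

datatype 'a lie_term = LGen 'a | LBr "'a lie_term" "'a lie_term"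

fun ldeg :: "nat \<Rightarrow> nat \<Rightarrow> 'a lie_term \<Rightarrow> nat"
  where
  "ldeg d m (LGen _) = d"
| "ldeg d m (LBr a b) = ldeg d m a + ldeg d m b + (m - 1)"

abbreviation lmono :: "'a lie_term \<Rightarrow> ('a lie_term \<Rightarrow>\<^sub>0 rat)"
  where "lmono t \<equiv> Poly_Mapping.single t 1"

text \<open>Graded antisymmetry and the graded Jacobi identity, both with the signs of a bracket of
  degree \<open>m - 1\<close>. Both identities are multilinear, so imposing them on monomials imposes them on
  all homogeneous elements.\<close>

definition lie_relators :: "nat \<Rightarrow> nat \<Rightarrow> 'a set \<Rightarrow> ('a lie_term \<Rightarrow>\<^sub>0 rat) set"
  where "lie_relators d m S =
    (let T = {t. set_lie_term t \<subseteq> S}; e = (\<lambda>t. ldeg d m t + (m - 1)) in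
      {lmono (LBr a b) + pm_scale (gsign (e a * e b)) (lmono (LBr b a)) | a b. a \<in> T \<and> b \<in> T}
    \<union> {lmono (LBr a (LBr b c)) - lmono (LBr (LBr a b) c)
         - pm_scale (gsign (e a * e b)) (lmono (LBr b (LBr a c)))
        | a b c. a \<in> T \<and> b \<in> T \<and> c \<in> T})"

definition lie_ideal :: "nat \<Rightarrow> nat \<Rightarrow> 'a set \<Rightarrow> ('a lie_term \<Rightarrow>\<^sub>0 rat) set"
  where "lie_ideal d m S = gen_ideal {LBr} {t. set_lie_term t \<subseteq> S} (lie_relators d m S)"

definition lie_fi :: "nat \<Rightarrow> nat \<Rightarrow> nat \<Rightarrow> (nat lie_term \<Rightarrow>\<^sub>0 rat) set fi_data"
  where "lie_fi d m l = free_alg_piece set_lie_term map_lie_term (ldeg d m) (lie_ideal d m) l"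

subsection \<open>Gerstenhaber algebras with bracket of degree \<open>m - 1\<close>\<close>

datatype 'a gerst_term =
  GGen 'a | GOne | GProd "'a gerst_term" "'a gerst_term" | GBr "'a gerst_term" "'a gerst_term"

fun gdeg :: "nat \<Rightarrow> nat \<Rightarrow> 'a gerst_term \<Rightarrow> nat"
  where
  "gdeg d m (GGen _) = d"
| "gdeg d m GOne = 0"
| "gdeg d m (GProd a b) = gdeg d m a + gdeg d m b"
| "gdeg d m (GBr a b) = gdeg d m a + gdeg d m b + (m - 1)"

abbreviation gmono :: "'a gerst_term \<Rightarrow> ('a gerst_term \<Rightarrow>\<^sub>0 rat)"
  where "gmono t \<equiv> Poly_Mapping.single t 1"

text \<open>In this order: unit, associativity and graded commutativity of the product; graded
  antisymmetry and graded Jacobi identity of the bracket; Poisson identity, saying that bracketing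
  with \<open>a\<close> is a derivation of the product of degree \<open>|a| + m - 1\<close>.\<close>

definition gerst_relators :: "nat \<Rightarrow> nat \<Rightarrow> 'a set \<Rightarrow> ('a gerst_term \<Rightarrow>\<^sub>0 rat) set"
  where "gerst_relators d m S =
    (let T = {t. set_gerst_term t \<subseteq> S}; deg = gdeg d m; e = (\<lambda>t. deg t + (m - 1)) in
      {gmono (GProd GOne a) - gmono a | a. a \<in> T}
    \<union> {gmono (GProd (GProd a b) c) - gmono (GProd a (GProd b c))
        | a b c. a \<in> T \<and> b \<in> T \<and> c \<in> T}
    \<union> {gmono (GProd a b) - pm_scale (gsign (deg a * deg b)) (gmono (GProd b a))
        | a b. a \<in> T \<and> b \<in> T}
    \<union> {gmono (GBr a b) + pm_scale (gsign (e a * e b)) (gmono (GBr b a)) | a b. a \<in> T \<and> b \<in> T}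
    \<union> {gmono (GBr a (GBr b c)) - gmono (GBr (GBr a b) c)
         - pm_scale (gsign (e a * e b)) (gmono (GBr b (GBr a c)))
        | a b c. a \<in> T \<and> b \<in> T \<and> c \<in> T}
    \<union> {gmono (GBr a (GProd b c)) - gmono (GProd (GBr a b) c)
         - pm_scale (gsign (e a * deg b)) (gmono (GProd b (GBr a c)))
        | a b c. a \<in> T \<and> b \<in> T \<and> c \<in> T})"

definition gerst_ideal :: "nat \<Rightarrow> nat \<Rightarrow> 'a set \<Rightarrow> ('a gerst_term \<Rightarrow>\<^sub>0 rat) set"
  where "gerst_ideal d m S =
    gen_ideal {GProd, GBr} {t. set_gerst_term t \<subseteq> S} (gerst_relators d m S)"

definition gerst_fi :: "nat \<Rightarrow> nat \<Rightarrow> nat \<Rightarrow> ((nat gerst_term \<Rightarrow>\<^sub>0 rat) set \<Rightarrow> rat) fi_data"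
  where "gerst_fi d m l =
    dual_fi (free_alg_piece set_gerst_term map_gerst_term (gdeg d m) (gerst_ideal d m) l)"

end

theory Submission
  imports Defs
begin

text \<open>Both functors come from quotients of spaces spanned by monomials in the generators, and the number
  of different letters in a monomial bounds the weight. In degree \<open>l\<close> a monomial has at most
  \<open>k = l div d\<close> letters, since every letter has degree \<open>d\<close> and no operation lowers the degree. Already
  this crude bound is good enough: \<open>(m + 2) d \<ge> m + d\<close>, so \<open>k \<le> l / d \<le> (m + 2) / (m + d) * l\<close>.

  That \<open>k\<close> letters give weight at most \<open>k\<close> is usually seen from Pieri's rule. Here it is
  proved directly with polytabloids. The \<open>FI#\<close> structure provides, for each \<open>A \<subseteq> {1..n}\<close>, an idempotent
  that sets the letters outside \<open>A\<close> to zero and absorbs all permutations fixing \<open>A\<close> pointwise. If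
  \<open>card A \<le> k < |\<nu>|\<close>, then two elements outside \<open>A\<close> lie in one column of any tableau of shape
  \<open>(n - |\<nu>|, \<nu>)\<close>, because there are only \<open>n - |\<nu>|\<close> columns. Their transposition negates the polytabloid
  and is absorbed by the idempotent, so the idempotent kills the image of the polytabloid under every
  equivariant map (\<open>weight_le_if_detected_by_subsets\<close>). It remains to see that only the zero vector is
  killed by the idempotents of all \<open>A\<close> with at most \<open>k\<close> elements. For the free algebra in degree \<open>l\<close>
  this is an inclusion-exclusion over sets of letters (\<open>piece_detected_by_subsets\<close>), and for its dual it
  says that the monomials span (\<open>dual_piece_detected_by_subsets\<close>).

  The \<open>FI#\<close>-module axioms come down to the fact that every relator is homogeneous in its set of
  letters, so that setting letters to zero maps relators to relators or to zero.\<close>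

section \<open>Rational vector spaces\<close>

lemma rat_linearI:
  assumes "rat_vectorspace V" "rat_vectorspace W"
    and "\<And>x. x \<in> carrier V \<Longrightarrow> h x \<in> carrier W"
    and "\<And>x y. x \<in> carrier V \<Longrightarrow> y \<in> carrier V \<Longrightarrow> h (x \<oplus>\<^bsub>V\<^esub> y) = h x \<oplus>\<^bsub>W\<^esub> h y"
    and "\<And>c x. x \<in> carrier V \<Longrightarrow> h (c \<odot>\<^bsub>V\<^esub> x) = c \<odot>\<^bsub>W\<^esub> h x"
  shows "rat_linear V W h"
  using assms
  by (auto intro!: linear_map.intro mod_hom.intro
      simp: mod_hom_axioms_def LinearCombinations.module_hom_def vectorspace_def)

lemma
  assumes "rat_linear V W h"
  shows rat_linear_dom: "rat_vectorspace V"
    and rat_linear_cod: "rat_vectorspace W"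
    and rat_linear_closed: "x \<in> carrier V \<Longrightarrow> h x \<in> carrier W"
    and rat_linear_add: "x \<in> carrier V \<Longrightarrow> y \<in> carrier V \<Longrightarrow> h (x \<oplus>\<^bsub>V\<^esub> y) = h x \<oplus>\<^bsub>W\<^esub> h y"
    and rat_linear_smult: "x \<in> carrier V \<Longrightarrow> h (c \<odot>\<^bsub>V\<^esub> x) = c \<odot>\<^bsub>W\<^esub> h x"
  using assms
  by (auto simp: linear_map_def mod_hom_def mod_hom_axioms_def LinearCombinations.module_hom_def)

lemma
  assumes "rat_vectorspace V"
  shows rat_vs_zero: "\<zero>\<^bsub>V\<^esub> \<in> carrier V"
    and rat_vs_add: "x \<in> carrier V \<Longrightarrow> y \<in> carrier V \<Longrightarrow> x \<oplus>\<^bsub>V\<^esub> y \<in> carrier V"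
    and rat_vs_smult: "x \<in> carrier V \<Longrightarrow> c \<odot>\<^bsub>V\<^esub> x \<in> carrier V"
    and rat_vs_smult_zero: "c \<odot>\<^bsub>V\<^esub> \<zero>\<^bsub>V\<^esub> = \<zero>\<^bsub>V\<^esub>"
    and rat_vs_zero_smult: "x \<in> carrier V \<Longrightarrow> 0 \<odot>\<^bsub>V\<^esub> x = \<zero>\<^bsub>V\<^esub>"
    and rat_vs_one_smult: "x \<in> carrier V \<Longrightarrow> 1 \<odot>\<^bsub>V\<^esub> x = x"
    and rat_vs_smult_smult: "x \<in> carrier V \<Longrightarrow> a \<odot>\<^bsub>V\<^esub> (b \<odot>\<^bsub>V\<^esub> x) = (a * b) \<odot>\<^bsub>V\<^esub> x"
    and rat_vs_add_smult: "x \<in> carrier V \<Longrightarrow> (a + b) \<odot>\<^bsub>V\<^esub> x = a \<odot>\<^bsub>V\<^esub> x \<oplus>\<^bsub>V\<^esub> b \<odot>\<^bsub>V\<^esub> x"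
proof -
  interpret V: vectorspace "class_ring :: rat ring" V by (rule assms)
  show "\<zero>\<^bsub>V\<^esub> \<in> carrier V" by simp
  show "x \<in> carrier V \<Longrightarrow> y \<in> carrier V \<Longrightarrow> x \<oplus>\<^bsub>V\<^esub> y \<in> carrier V" by simp
  show "x \<in> carrier V \<Longrightarrow> c \<odot>\<^bsub>V\<^esub> x \<in> carrier V" using V.smult_closed[of c x] by simp
  show "c \<odot>\<^bsub>V\<^esub> \<zero>\<^bsub>V\<^esub> = \<zero>\<^bsub>V\<^esub>" using V.smult_r_null[of c] by simp
  show "x \<in> carrier V \<Longrightarrow> 0 \<odot>\<^bsub>V\<^esub> x = \<zero>\<^bsub>V\<^esub>" using V.smult_l_null[of x] by simp
  show "x \<in> carrier V \<Longrightarrow> 1 \<odot>\<^bsub>V\<^esub> x = x" using V.smult_one[of x] by simp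
  show "x \<in> carrier V \<Longrightarrow> a \<odot>\<^bsub>V\<^esub> (b \<odot>\<^bsub>V\<^esub> x) = (a * b) \<odot>\<^bsub>V\<^esub> x"
    using V.smult_assoc1[of a b x] by simp
  show "x \<in> carrier V \<Longrightarrow> (a + b) \<odot>\<^bsub>V\<^esub> x = a \<odot>\<^bsub>V\<^esub> x \<oplus>\<^bsub>V\<^esub> b \<odot>\<^bsub>V\<^esub> x"
    using V.smult_l_distr[of a b x] by simp
qed

lemma rat_linear_zero: "rat_linear V W h \<Longrightarrow> h \<zero>\<^bsub>V\<^esub> = \<zero>\<^bsub>W\<^esub>"
  using rat_linear_smult[of V W h "\<zero>\<^bsub>V\<^esub>" 0] rat_linear_closed[of V W h "\<zero>\<^bsub>V\<^esub>"]
  by (simp add: rat_vs_zero rat_vs_smult_zero rat_vs_zero_smult rat_linear_dom rat_linear_cod)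

text \<open>This will be applied to the image of a polytabloid, which a transposition both fixes and negates.\<close>

lemma rat_vs_eq_neg_imp_zero:
  assumes V: "rat_vectorspace V" and x: "x \<in> carrier V" and eq: "x = (- 1) \<odot>\<^bsub>V\<^esub> x"
  shows "x = \<zero>\<^bsub>V\<^esub>"
proof -
  have "2 \<odot>\<^bsub>V\<^esub> x = (1 + 1) \<odot>\<^bsub>V\<^esub> x" by simp
  also have "\<dots> = x \<oplus>\<^bsub>V\<^esub> x"
    using x V by (subst rat_vs_add_smult) (simp_all add: rat_vs_one_smult)
  also have "\<dots> = 1 \<odot>\<^bsub>V\<^esub> x \<oplus>\<^bsub>V\<^esub> (- 1) \<odot>\<^bsub>V\<^esub> x"
    using x V eq by (simp add: rat_vs_one_smult)
  also have "\<dots> = (1 + - 1) \<odot>\<^bsub>V\<^esub> x"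
    using x V by (subst rat_vs_add_smult) simp_all
  finally have two: "2 \<odot>\<^bsub>V\<^esub> x = \<zero>\<^bsub>V\<^esub>" using x V by (simp add: rat_vs_zero_smult)
  have "x = (1 / 2) \<odot>\<^bsub>V\<^esub> (2 \<odot>\<^bsub>V\<^esub> x)"
    using x V by (subst rat_vs_smult_smult) (simp_all add: rat_vs_one_smult)
  then show ?thesis using two V by (simp add: rat_vs_smult_zero)
qed

section \<open>Linear extension\<close>

text \<open>Summing over any finite set containing the keys makes linearity in \<open>v\<close> a term-by-term statement.\<close>

lemma lin_ext_superset:
  assumes "finite K" "Poly_Mapping.keys v \<subseteq> K"
  shows "lin_ext f v = (\<Sum>k\<in>K. pm_scale (Poly_Mapping.lookup v k) (f k))"
  unfolding lin_ext_def
  using assms by (intro sum.mono_neutral_left) (auto simp: in_keys_iff)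

lemma lin_ext_zero [simp]: "lin_ext f 0 = 0"
  by (simp add: lin_ext_def)

lemma lin_ext_add: "lin_ext f (v + w) = lin_ext f v + lin_ext f w"
proof -
  let ?K = "Poly_Mapping.keys v \<union> Poly_Mapping.keys w"
  have "lin_ext f u = (\<Sum>k\<in>?K. pm_scale (Poly_Mapping.lookup u k) (f k))" if "u \<in> {v, w, v + w}" for u
    using that Poly_Mapping.keys_add[of v w] by (intro lin_ext_superset) auto
  then show ?thesis by (simp add: lookup_add pm.scale_left_distrib sum.distrib)
qed

lemma lin_ext_scale: "lin_ext f (pm_scale c v) = pm_scale c (lin_ext f v)"
proof -
  have "Poly_Mapping.keys (pm_scale c v) \<subseteq> Poly_Mapping.keys v" by (auto simp: in_keys_iff)
  then have "lin_ext f (pm_scale c v) =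
      (\<Sum>k\<in>Poly_Mapping.keys v. pm_scale (Poly_Mapping.lookup (pm_scale c v) k) (f k))"
    by (intro lin_ext_superset) auto
  then show ?thesis by (simp add: lin_ext_def pm.scale_sum_right)
qed

lemma lin_ext_diff: "lin_ext f (v - w) = lin_ext f v - lin_ext f w"
  using lin_ext_add[of f "v - w" w] by simp

lemma lin_ext_sum: "lin_ext f (sum g X) = (\<Sum>x\<in>X. lin_ext f (g x))"
  by (induction X rule: infinite_finite_induct) (simp_all add: lin_ext_add)

lemma lin_ext_single [simp]: "lin_ext f (Poly_Mapping.single k c) = pm_scale c (f k)"
  by (subst lin_ext_superset[of "{k}"]) auto

lemma lin_ext_const_zero [simp]: "lin_ext (\<lambda>k. 0) v = 0"
  by (simp add: lin_ext_def)

lemma lin_ext_lin_ext: "lin_ext g (lin_ext f v) = lin_ext (\<lambda>k. lin_ext g (f k)) v"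
  unfolding lin_ext_def[of f v] lin_ext_def[of _ v] by (simp add: lin_ext_sum lin_ext_scale)

lemma lin_ext_cong:
  "(\<And>k. k \<in> Poly_Mapping.keys v \<Longrightarrow> f k = g k) \<Longrightarrow> lin_ext f v = lin_ext g v"
  by (simp add: lin_ext_def)

lemma pm_scale_single [simp]:
  "pm_scale c (Poly_Mapping.single k a) = Poly_Mapping.single k (c * a)"
  by (rule poly_mapping_eqI) (simp add: lookup_single when_def)

lemma lin_ext_basis: "lin_ext (\<lambda>k. Poly_Mapping.single k 1) v = v"
  by (rule poly_mapping_eqI)
    (simp add: lin_ext_def lookup_sum lookup_single when_def in_keys_iff)

section \<open>Polytabloids\<close>

lemma diagram_Sigma: "diagram \<mu> = Sigma {..<length \<mu>} (\<lambda>i. {..<\<mu> ! i})"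
  by (auto simp: diagram_def)

lemma ex_tableau: "\<exists>t. tableau \<mu> t"
proof -
  have "card (diagram \<mu>) = sum_list \<mu>"
    by (simp add: diagram_Sigma sum_list_sum_nth atLeast0LessThan)
  then show ?thesis
    unfolding tableau_def
    by (intro finite_same_card_bij) (auto simp: diagram_Sigma)
qed

lemma finite_column_stabilizer: "finite (column_stabilizer \<mu> t)"
  by (rule finite_subset[OF _ finite_permutations[of "{1..sum_list \<mu>}"]])
    (auto simp: column_stabilizer_def)

text \<open>A cell is the intersection of its row and its column, so a permutation that respects both kinds
  of sets fixes every entry.\<close>

lemma row_column_stabilizer_trivial:
  assumes t: "tableau \<mu> t" and \<sigma>: "\<sigma> \<in> column_stabilizer \<mu> t"
    and rows: "map ((`) \<sigma>) (tabloid \<mu> t) = tabloid \<mu> t"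
  shows "\<sigma> = id"
proof
  fix x
  show "\<sigma> x = id x"
  proof (cases "x \<in> {1..sum_list \<mu>}")
    case True
    then obtain i j where ij: "(i, j) \<in> diagram \<mu>" and x: "x = t (i, j)"
      using t by (force simp: tableau_def bij_betw_def)
    have inj: "inj_on t (diagram \<mu>)" using t by (simp add: tableau_def bij_betw_def)
    have i: "i < length \<mu>" "j < \<mu> ! i" using ij by (auto simp: diagram_def)
    have "\<sigma> ` {t (i, j) | j. j < \<mu> ! i} = {t (i, j) | j. j < \<mu> ! i}"
      using arg_cong[OF rows, of "\<lambda>T. T ! i"] i by (simp add: tabloid_def)
    then have "\<sigma> x \<in> {t (i, j) | j. j < \<mu> ! i}" using i x by blast
    then obtain j' where j': "\<sigma> x = t (i, j')" "(i, j') \<in> diagram \<mu>"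
      using i by (auto simp: diagram_def)
    have "\<sigma> ` column \<mu> t j = column \<mu> t j" using \<sigma> by (simp add: column_stabilizer_def)
    moreover have "x \<in> column \<mu> t j" using ij x by (auto simp: column_def)
    ultimately have "\<sigma> x \<in> column \<mu> t j" by blast
    then obtain i' where "\<sigma> x = t (i', j)" "(i', j) \<in> diagram \<mu>" by (auto simp: column_def)
    then have "(i, j') = (i', j)" using j' inj by (metis inj_onD)
    then show ?thesis using j' x by simp
  next
    case False
    then show ?thesis using \<sigma> by (auto simp: column_stabilizer_def permutes_def)
  qed
qed

text \<open>By \<open>row_column_stabilizer_trivial\<close> only the identity contributes to the coefficient of
  the tabloid of \<open>t\<close> itself, and this coefficient is therefore \<open>1\<close>.\<close>

lemma polytabloid_nonzero:
  assumes "tableau \<mu> t"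
  shows "polytabloid \<mu> t \<noteq> 0"
proof -
  have id: "id \<in> column_stabilizer \<mu> t" by (simp add: column_stabilizer_def permutes_id)
  have "Poly_Mapping.lookup (polytabloid \<mu> t) (tabloid \<mu> t) =
      (\<Sum>\<sigma>\<in>column_stabilizer \<mu> t. if \<sigma> = id then 1 else 0)"
    unfolding polytabloid_def lookup_sum
    using row_column_stabilizer_trivial[OF assms]
    by (intro sum.cong) (auto simp: lookup_single when_def sign_id)
  also have "\<dots> = 1" using id by (simp add: finite_column_stabilizer)
  finally show ?thesis by auto
qed

text \<open>Composition with the transposition is an involution of the column stabilizer that reverses all
  signs.\<close>

lemma column_transposition_polytabloid:
  assumes t: "tableau \<mu> t" and ab: "a \<in> column \<mu> t j" "b \<in> column \<mu> t j" "a \<noteq> b"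
  shows "specht_action (transpose a b) (polytabloid \<mu> t) = pm_scale (- 1) (polytabloid \<mu> t)"
proof -
  let ?\<tau> = "transpose a b" and ?C = "column_stabilizer \<mu> t"
  have cell: "\<exists>i. (i, j) \<in> diagram \<mu> \<and> x = t (i, j)" if "x \<in> column \<mu> t j" for x j
    using that by (auto simp: column_def)
  have inj: "inj_on t (diagram \<mu>)" using t by (simp add: tableau_def bij_betw_def)
  have in_n: "x \<in> {1..sum_list \<mu>}" if "x \<in> column \<mu> t j" for x
    using cell[OF that] t by (auto simp: tableau_def bij_betw_def)
  have perm: "?\<tau> permutes {1..sum_list \<mu>}" using ab in_n by (intro permutes_swap_id) auto
  have "?\<tau> ` column \<mu> t j' = column \<mu> t j'" for j'
  proof (cases "j' = j")
    case True then show ?thesis using ab by (simp add: transpose_image_eq)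
  next
    case False
    have "a \<notin> column \<mu> t j' \<and> b \<notin> column \<mu> t j'"
      using cell ab inj False by (metis inj_onD prod.inject)
    then show ?thesis by (simp add: transpose_image_eq)
  qed
  then have \<tau>: "?\<tau> \<in> ?C" using perm by (simp add: column_stabilizer_def)
  have closed: "?\<tau> \<circ> \<sigma> \<in> ?C" if "\<sigma> \<in> ?C" for \<sigma>
    using that \<tau> by (simp add: column_stabilizer_def permutes_compose image_comp[symmetric] del: o_apply)
  have sign: "sign (?\<tau> \<circ> \<sigma>) = - sign \<sigma>" if "\<sigma> \<in> ?C" for \<sigma>
    using that perm ab
    by (subst sign_compose)
      (auto simp: column_stabilizer_def sign_swap_id intro: permutation_permutes[THEN iffD2])
  have "specht_action ?\<tau> (polytabloid \<mu> t) =
      (\<Sum>\<sigma>\<in>?C. Poly_Mapping.single (map ((`) (?\<tau> \<circ> \<sigma>)) (tabloid \<mu> t)) (of_int (sign \<sigma>)))"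
    by (simp add: specht_action_def polytabloid_def lin_ext_sum image_comp comp_def)
  \<comment> \<open>the substitution \<open>\<sigma> \<mapsto> \<tau> \<circ> \<sigma>\<close>\<close>
  also have "\<dots> = (\<Sum>\<sigma>\<in>?C. Poly_Mapping.single (map ((`) \<sigma>) (tabloid \<mu> t)) (- of_int (sign \<sigma>)))"
    by (rule sum.reindex_bij_witness[of _ "(\<circ>) ?\<tau>" "(\<circ>) ?\<tau>"])
      (auto simp: closed sign comp_assoc[symmetric])
  also have "\<dots> = pm_scale (- 1) (polytabloid \<mu> t)"
    by (simp add: polytabloid_def pm.scale_sum_right)
  finally show ?thesis .
qed

section \<open>Weight and restriction to small subsets\<close>

text \<open>For \<open>A \<subseteq> S\<close> the morphism \<open>fi_id A\<close>, regarded as an endomorphism of \<open>S\<close>, is the idempotent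
  that forgets the points outside \<open>A\<close>; on a free algebra it sets the generators outside \<open>A\<close> to zero.
  The condition below says that these idempotents for \<open>card A \<le> k\<close> are jointly injective. It is the form
  of ``generated in degrees at most \<open>k\<close>'' that can be tested on a single vector, and it makes sense in
  the same way for a module and for its dual.\<close>

definition detected_by_subsets :: "nat \<Rightarrow> 'v fi_data \<Rightarrow> bool"
  where "detected_by_subsets k F \<longleftrightarrow> (\<forall>S. finite S \<longrightarrow> (\<forall>x\<in>carrier (fi_obj F S).
    (\<forall>A\<subseteq>S. card A \<le> k \<longrightarrow> fi_map F S S (fi_id A) x = \<zero>\<^bsub>fi_obj F S\<^esub>) \<longrightarrow>
    x = \<zero>\<^bsub>fi_obj F S\<^esub>))"

lemma fi_id_in_hom: "A \<subseteq> S \<Longrightarrow> A \<subseteq> T \<Longrightarrow> fi_id A \<in> fi_hom S T"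
  by (auto simp: fi_id_def fi_hom_def bij_betw_def inj_on_def)

lemma
  assumes "fi_sharp_module F" "finite S"
  shows fi_sharp_module_vs: "rat_vectorspace (fi_obj F S)"
    and fi_sharp_module_linear:
      "finite T \<Longrightarrow> f \<in> fi_hom S T \<Longrightarrow> rat_linear (fi_obj F S) (fi_obj F T) (fi_map F S T f)"
    and fi_sharp_module_id: "x \<in> carrier (fi_obj F S) \<Longrightarrow> fi_map F S S (fi_id S) x = x"
    and fi_sharp_module_comp: "finite T \<Longrightarrow> finite U \<Longrightarrow> f \<in> fi_hom S T \<Longrightarrow> g \<in> fi_hom T U \<Longrightarrow>
      x \<in> carrier (fi_obj F S) \<Longrightarrow>
      fi_map F S U (fi_comp g f) x = fi_map F T U g (fi_map F S T f x)"
  using assms unfolding fi_sharp_module_def by meson+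

lemma fi_comp_fi_id:
  assumes "{y \<in> S. g y \<in> A} = A" and "\<And>a. a \<in> A \<Longrightarrow> g a = a"
  shows "fi_comp (fi_id A) (S, T, g) = fi_id A"
proof -
  have "g ` A = A" "(\<lambda>x\<in>A. x) ` A = A" using assms(2) by force+
  then show ?thesis
    using assms by (simp add: fi_id_def Let_def cong: restrict_cong) auto
qed

text \<open>A permutation that fixes \<open>A\<close> pointwise cannot be seen after forgetting the complement of \<open>A\<close>:
  already in \<open>FI#\<close> its composite with \<open>fi_id A\<close> is \<open>fi_id A\<close>.\<close>

lemma fi_map_fi_id_sym_action:
  assumes F: "fi_sharp_module F" and A: "A \<subseteq> {1..n}" and \<sigma>: "\<sigma> permutes {1..n}"
    and fix_A: "\<And>a. a \<in> A \<Longrightarrow> \<sigma> a = a" and x: "x \<in> carrier (fi_obj F {1..n})"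
  shows "fi_map F {1..n} {1..n} (fi_id A) (sym_action F n \<sigma> x) = fi_map F {1..n} {1..n} (fi_id A) x"
proof -
  let ?n = "{1..n}" and ?f = "({1..n}, {1..n}, restrict \<sigma> {1..n})"
  have f: "?f \<in> fi_hom ?n ?n"
    using permutes_imp_bij[OF \<sigma>]
    by (simp add: fi_hom_def bij_betw_cong[of ?n "restrict \<sigma> ?n" \<sigma>])
  have D: "{y \<in> ?n. restrict \<sigma> ?n y \<in> A} = A"
  proof -
    have "\<sigma> y \<in> A \<longleftrightarrow> y \<in> A" for y
      using fix_A[of y] fix_A[of "\<sigma> y"] permutes_inj[OF \<sigma>] by (metis injD)
    then have "{y \<in> ?n. restrict \<sigma> ?n y \<in> A} = {y \<in> ?n. y \<in> A}"
      by (intro Collect_cong conj_cong) simp_all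
    then show ?thesis using A by blast
  qed
  have "restrict \<sigma> ?n a = a" if "a \<in> A" for a using that A fix_A by auto
  then have "fi_comp (fi_id A) ?f = fi_id A" by (intro fi_comp_fi_id D)
  then show ?thesis
    using fi_sharp_module_comp[OF F _ _ _ f fi_id_in_hom[OF A A] x] by (simp add: sym_action_def)
qed

text \<open>Let \<open>\<mu> = (n - |\<nu>|, \<nu>)\<close> and suppose that \<open>|\<nu>| > k\<close>. If \<open>card A \<le> k\<close>, then the complement of \<open>A\<close>
  has more than \<open>n - |\<nu>|\<close> elements, which is the number of columns of \<open>\<mu>\<close>. So some column of a tableau
  \<open>t\<close> contains two elements outside \<open>A\<close>. Their transposition negates the polytabloid \<open>e\<close> of \<open>t\<close>, but
  it becomes invisible after applying \<open>fi_id A\<close>; hence an equivariant map sends \<open>e\<close> to a vector that is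
  killed by every such \<open>fi_id A\<close>. That vector is zero by detection, so the map is not injective.\<close>

lemma weight_le_if_detected_by_subsets:
  assumes F: "fi_sharp_module F" and k: "detected_by_subsets k F" and s: "real k \<le> s"
  shows "weight_le F s"
  unfolding weight_le_def
proof (intro allI impI)
  fix n \<nu>
  assume \<nu>: "is_partition \<nu>" "sum_list \<nu> + first_part \<nu> \<le> n"
    and con: "constituent n (specht ((n - sum_list \<nu>) # \<nu>)) specht_action
        (fi_obj F {1..n}) (sym_action F n)"
  let ?\<mu> = "(n - sum_list \<nu>) # \<nu>" and ?W = "fi_obj F {1..n}"
  let ?p = "\<lambda>A. fi_map F {1..n} {1..n} (fi_id A)"
  have size: "sum_list ?\<mu> = n" using \<nu> by simp
  obtain h where h: "rat_linear (specht ?\<mu>) ?W h" "inj_on h (carrier (specht ?\<mu>))"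
    "\<And>\<sigma> v. \<sigma> permutes {1..n} \<Longrightarrow> v \<in> carrier (specht ?\<mu>) \<Longrightarrow>
      h (specht_action \<sigma> v) = sym_action F n \<sigma> (h v)"
    using con unfolding constituent_def by blast
  obtain t where t: "tableau ?\<mu> t" using ex_tableau by blast
  let ?e = "polytabloid ?\<mu> t"
  have e: "?e \<in> carrier (specht ?\<mu>)"
    using t by (auto simp: specht_def pm_vs_def intro: pm.span_base)
  have he: "h ?e \<in> carrier ?W" using h(1) e by (rule rat_linear_closed)
  have "sum_list \<nu> \<le> k"
  proof (rule ccontr)
    assume "\<not> sum_list \<nu> \<le> k"
    have "?p A (h ?e) = \<zero>\<^bsub>?W\<^esub>" if A: "A \<subseteq> {1..n}" "card A \<le> k" for A
    proof -
      have bij: "bij_betw t (diagram ?\<mu>) {1..n}" using t unfolding tableau_def size .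
      \<comment> \<open>\<open>c x\<close> is the column of \<open>t\<close> that contains \<open>x\<close>\<close>
      define c where "c x = snd (inv_into (diagram ?\<mu>) t x)" for x
      have cell: "inv_into (diagram ?\<mu>) t x \<in> diagram ?\<mu>"
        "t (inv_into (diagram ?\<mu>) t x) = x" if "x \<in> {1..n}" for x
        using that bij by (auto simp: bij_betw_def inv_into_into f_inv_into_f)
      have col: "x \<in> column ?\<mu> t (c x)" if "x \<in> {1..n}" for x
        using cell[OF that] unfolding column_def c_def by (auto simp: prod_eq_iff) (metis prod.collapse)
      \<comment> \<open>the first row is the longest, so its length is the number of columns\<close>
      have "j < n - sum_list \<nu>" if "(i, j) \<in> diagram ?\<mu>" for i j
      proof (cases i)
        case 0
        then show ?thesis using that by (simp add: diagram_def)
      next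
        case (Suc i')
        then have i': "i' < length \<nu>" "j < \<nu> ! i'" using that by (auto simp: diagram_def)
        have "\<nu> ! i' \<le> first_part \<nu>"
          using \<nu>(1) i'(1)
          by (cases \<nu>; cases i') (auto simp: is_partition_def first_part_def)
        then show ?thesis using i' \<nu> by simp
      qed
      then have "c ` ({1..n} - A) \<subseteq> {..<n - sum_list \<nu>}"
        using cell(1) unfolding c_def by (auto, metis prod.collapse)
      then have "card (c ` ({1..n} - A)) \<le> n - sum_list \<nu>"
        by (metis card_lessThan card_mono finite_lessThan)
      also have "\<dots> < card ({1..n} - A)"
        using A \<open>\<not> sum_list \<nu> \<le> k\<close> \<nu> card_mono[OF _ A(1)]
        by (simp add: card_Diff_subset finite_subset[OF A(1)])
      finally have "\<not> inj_on c ({1..n} - A)" by (rule pigeonhole)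
      then obtain a b where ab: "a \<in> {1..n} - A" "b \<in> {1..n} - A" "c a = c b" "a \<noteq> b"
        by (auto simp: inj_on_def)
      let ?\<tau> = "transpose a b"
      have \<tau>: "?\<tau> permutes {1..n}" using ab by (intro permutes_swap_id) auto
      have "?p A (h ?e) = ?p A (sym_action F n ?\<tau> (h ?e))"
        using ab by (intro fi_map_fi_id_sym_action[OF F A(1) \<tau> _ he, symmetric])
          (metis DiffD2 transpose_apply_other)
      also have "sym_action F n ?\<tau> (h ?e) = h (pm_scale (- 1) ?e)"
        using h(3)[OF \<tau> e] column_transposition_polytabloid[OF t, of a "c a" b]
          col[of a] col[of b] ab by simp
      also have "\<dots> = (- 1) \<odot>\<^bsub>?W\<^esub> h ?e"
        using rat_linear_smult[OF h(1) e, of "- 1"] by (simp add: specht_def pm_vs_def)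
      finally have eq: "?p A (h ?e) = ?p A ((- 1) \<odot>\<^bsub>?W\<^esub> h ?e)" .
      have lin: "rat_linear ?W ?W (?p A)"
        using F A(1) by (simp add: fi_sharp_module_linear fi_id_in_hom)
      have "?p A (h ?e) = (- 1) \<odot>\<^bsub>?W\<^esub> ?p A (h ?e)"
        using eq rat_linear_smult[OF lin he, of "- 1"] by (rule trans)
      then show ?thesis
        by (intro rat_vs_eq_neg_imp_zero rat_linear_cod[OF lin] rat_linear_closed[OF lin he])
    qed
    then have "h ?e = \<zero>\<^bsub>?W\<^esub>" using k he unfolding detected_by_subsets_def by blast
    then have "h ?e = h \<zero>\<^bsub>specht ?\<mu>\<^esub>" using rat_linear_zero[OF h(1)] by simp
    then have "?e = \<zero>\<^bsub>specht ?\<mu>\<^esub>"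
      using h(2) e rat_vs_zero[OF rat_linear_dom[OF h(1)]] by (simp add: inj_onD)
    then show False using polytabloid_nonzero[OF t] by (simp add: specht_def pm_vs_def)
  qed
  then show "real (sum_list \<nu>) \<le> s" using s by linarith
qed

section \<open>Quotient spaces\<close>

lemma pm_coset_eq_iff:
  assumes I: "pm.subspace I"
  shows "pm_coset I x = pm_coset I y \<longleftrightarrow> x - y \<in> I"
proof
  assume "pm_coset I x = pm_coset I y"
  moreover have "x \<in> pm_coset I x" using pm.subspace_0[OF I] by (force simp: pm_coset_def)
  ultimately show "x - y \<in> I" by (auto simp: pm_coset_def)
next
  assume xy: "x - y \<in> I"
  have "x + i = y + (x - y + i) \<and> y + i = x + (i - (x - y))" for i by (simp add: algebra_simps)
  moreover have "x - y + i \<in> I \<and> i - (x - y) \<in> I" if "i \<in> I" for i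
    using I xy that by (simp add: pm.subspace_add pm.subspace_diff)
  ultimately show "pm_coset I x = pm_coset I y" unfolding pm_coset_def by blast
qed

lemma pm_coset_zero: "pm_coset I 0 = I"
  by (simp add: pm_coset_def)

lemma carrier_quot_vs [simp]: "carrier (quot_vs W I) = pm_coset I ` W"
  and zero_quot_vs [simp]: "\<zero>\<^bsub>quot_vs W I\<^esub> = I"
  by (simp_all add: quot_vs_def)

lemma add_quot_vs:
  assumes I: "pm.subspace I"
  shows "pm_coset I x \<oplus>\<^bsub>quot_vs W I\<^esub> pm_coset I y = pm_coset I (x + y)"
proof -
  have "\<exists>a b. x + y + i = a + b \<and> (\<exists>i. a = x + i \<and> i \<in> I) \<and> (\<exists>i. b = y + i \<and> i \<in> I)"
    if "i \<in> I" for i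
    using that pm.subspace_0[OF I] by (intro exI[of _ "x + i"] exI[of _ y]) (auto simp: algebra_simps)
  moreover have "\<exists>k. x + i + (y + j) = x + y + k \<and> k \<in> I" if "i \<in> I" "j \<in> I" for i j
    using that I by (intro exI[of _ "i + j"]) (auto simp: algebra_simps pm.subspace_add)
  ultimately show ?thesis unfolding quot_vs_def pm_coset_def by auto
qed

lemma smult_quot_vs:
  assumes I: "pm.subspace I"
  shows "c \<odot>\<^bsub>quot_vs W I\<^esub> pm_coset I x = pm_coset I (pm_scale c x)"
proof -
  have "\<exists>a j. pm_scale c x + i = pm_scale c a + j \<and> (\<exists>i. a = x + i \<and> i \<in> I) \<and> j \<in> I"
    if "i \<in> I" for i
    using that pm.subspace_0[OF I] by (intro exI[of _ x] exI[of _ i]) auto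
  moreover have "\<exists>k. pm_scale c (x + i) + j = pm_scale c x + k \<and> k \<in> I" if "i \<in> I" "j \<in> I" for i j
    using that I
    by (intro exI[of _ "pm_scale c i + j"])
      (auto simp: pm.scale_right_distrib algebra_simps pm.subspace_add pm.subspace_scale)
  ultimately show ?thesis unfolding quot_vs_def pm_coset_def by auto
qed

lemma quot_vs_vectorspace:
  assumes I: "pm.subspace I" and W: "pm.subspace W"
  shows "rat_vectorspace (quot_vs W I)"
proof (rule vs_criteria, goal_cases)
  case 1 show ?case by (rule class_field)
next
  case 2 show ?case using pm.subspace_0[OF W] pm_coset_zero[of I] by (force simp: image_iff)
next
  case 3 show ?case using W by (auto simp: add_quot_vs[OF I] pm.subspace_add)
next
  case 4
  have "pm_coset I x \<oplus>\<^bsub>quot_vs W I\<^esub> pm_coset I (- x) = I" for x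
    by (simp add: add_quot_vs[OF I] pm_coset_zero)
  then show ?case using pm.subspace_neg[OF W] by auto
next
  case 5 show ?case using W by (auto simp: smult_quot_vs[OF I] pm.subspace_scale)
next
  case 6 show ?case by (auto simp: add_quot_vs[OF I] add.commute)
next
  case 7 show ?case by (auto simp: add_quot_vs[OF I] add.assoc)
next
  case 8
  have "pm_coset I x \<oplus>\<^bsub>quot_vs W I\<^esub> I = pm_coset I x" for x
    using add_quot_vs[OF I, where x = x and y = 0 and W = W] by (simp add: pm_coset_zero)
  then show ?case by auto
next
  case 9 show ?case by (auto simp: smult_quot_vs[OF I])
next
  case 10 show ?case by (auto simp: smult_quot_vs[OF I])
next
  case 11 show ?case by (auto simp: smult_quot_vs[OF I] add_quot_vs[OF I] pm.scale_left_distrib)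
next
  case 12 show ?case by (auto simp: smult_quot_vs[OF I] add_quot_vs[OF I] pm.scale_right_distrib)
qed

section \<open>Dual modules\<close>

lemma carrier_dual_vs:
  "f \<in> carrier (dual_vs V) \<longleftrightarrow> f \<in> extensional (carrier V) \<and>
    (\<forall>x\<in>carrier V. \<forall>y\<in>carrier V. f (x \<oplus>\<^bsub>V\<^esub> y) = f x + f y) \<and>
    (\<forall>c. \<forall>x\<in>carrier V. f (c \<odot>\<^bsub>V\<^esub> x) = c * f x)"
  by (auto simp: dual_vs_def LinearCombinations.module_hom_def rat_line_def)

lemma dual_vs_sel [simp]:
  "\<zero>\<^bsub>dual_vs V\<^esub> = (\<lambda>x\<in>carrier V. 0)"
  "f \<oplus>\<^bsub>dual_vs V\<^esub> g = (\<lambda>x\<in>carrier V. f x + g x)"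
  "c \<odot>\<^bsub>dual_vs V\<^esub> f = (\<lambda>x\<in>carrier V. c * f x)"
  by (simp_all add: dual_vs_def)

lemma dual_vs_vectorspace:
  assumes V: "rat_vectorspace V"
  shows "rat_vectorspace (dual_vs V)"
proof (rule vs_criteria, goal_cases)
  note [simp] = carrier_dual_vs rat_vs_add[OF V] rat_vs_smult[OF V]
  case 1 show ?case by (rule class_field)
  case 2 show ?case by simp
  case 3 show ?case by (simp add: algebra_simps)
  case 4
  show ?case
  proof
    fix f assume "f \<in> carrier (dual_vs V)"
    then show "\<exists>g\<in>carrier (dual_vs V). f \<oplus>\<^bsub>dual_vs V\<^esub> g = \<zero>\<^bsub>dual_vs V\<^esub>"
      by (intro bexI[of _ "\<lambda>x\<in>carrier V. - f x"]) (simp_all cong: restrict_cong)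
  qed
  case 5 show ?case by (simp add: algebra_simps)
  case 6 show ?case by (simp add: algebra_simps)
  case 7 show ?case by (simp add: add.assoc cong: restrict_cong)
  case 8 show ?case by (simp add: extensional_restrict cong: restrict_cong)
  case 9 show ?case by (simp add: mult.assoc cong: restrict_cong)
  case 10 show ?case by (simp add: extensional_restrict cong: restrict_cong)
  case 11 show ?case by (simp add: distrib_right cong: restrict_cong)
  case 12 show ?case by (simp add: distrib_left cong: restrict_cong)
qed

lemma fi_inverse_in_hom: "f \<in> fi_hom S T \<Longrightarrow> fi_inverse f \<in> fi_hom T S"
  by (cases f) (auto simp: fi_hom_def bij_betw_inv_into cong: bij_betw_cong)

lemma fi_inverse_fi_id: "fi_inverse (fi_id A) = fi_id A"
proof -
  have "inv_into A (\<lambda>x\<in>A. x) y = y" if "y \<in> A" for y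
    using inv_into_f_f[of "\<lambda>x\<in>A. x" A y] that by (simp add: inj_on_def)
  then show ?thesis by (simp add: fi_id_def cong: restrict_cong)
qed

text \<open>Taking inverses is the isomorphism of \<open>FI#\<close> with its opposite category. The two sides have to be
  compared as triples: the domain \<open>E\<close> that arises on the right is the image of the domain \<open>D\<close> of the
  composite, and both maps on it are the same inverse.\<close>

lemma fi_inverse_comp:
  assumes f: "f \<in> fi_hom S T" and g: "g \<in> fi_hom T U"
  shows "fi_inverse (fi_comp g f) = fi_comp (fi_inverse f) (fi_inverse g)"
proof -
  obtain A B \<phi> where f': "f = (A, B, \<phi>)" by (cases f)
  obtain A' B' \<psi> where g': "g = (A', B', \<psi>)" by (cases g)
  have \<phi>: "inj_on \<phi> A" "\<phi> ` A = B" and \<psi>: "inj_on \<psi> A'" "\<psi> ` A' = B'"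
    using f g by (auto simp: f' g' fi_hom_def bij_betw_def)
  define D where "D = {x \<in> A. \<phi> x \<in> A'}"
  define E where "E = {y \<in> B'. (\<lambda>y\<in>B'. inv_into A' \<psi> y) y \<in> B}"
  have inv\<psi>: "inv_into A' \<psi> (\<psi> (\<phi> x)) = \<phi> x" and inv\<phi>: "inv_into A \<phi> (\<phi> x) = x" if "x \<in> D" for x
    using that \<phi> \<psi> by (simp_all add: D_def)
  have inj: "inj_on (\<lambda>x\<in>D. \<psi> (\<phi> x)) D"
    by (rule inj_onI) (metis inv\<psi> inv\<phi> restrict_apply')
  have inv: "inv_into D (\<lambda>x\<in>D. \<psi> (\<phi> x)) (\<psi> (\<phi> x)) = x" if "x \<in> D" for x
    using inv_into_f_f[OF inj that] that by simp
  have mem: "\<psi> (\<phi> x) \<in> B'" "\<phi> x \<in> B" if "x \<in> D" for x using that \<phi> \<psi> by (auto simp: D_def)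
  have E: "E = \<psi> ` \<phi> ` D"
  proof (intro equalityI subsetI)
    fix y assume "y \<in> E"
    then have y: "y \<in> B'" "inv_into A' \<psi> y \<in> B" by (auto simp: E_def)
    then obtain x where x: "x \<in> A" "\<phi> x = inv_into A' \<psi> y" using \<phi> by auto
    moreover have "inv_into A' \<psi> y \<in> A'" "\<psi> (inv_into A' \<psi> y) = y"
      using y \<psi> by (auto simp: inv_into_into f_inv_into_f)
    ultimately have "x \<in> D" "y = \<psi> (\<phi> x)" by (auto simp: D_def)
    then show "y \<in> \<psi> ` \<phi> ` D" by blast
  next
    fix y assume "y \<in> \<psi> ` \<phi> ` D"
    then show "y \<in> E" using mem by (auto simp: E_def inv\<psi>)
  qed
  let ?g = "\<lambda>y\<in>B'. inv_into A' \<psi> y" and ?f = "\<lambda>y\<in>B. inv_into A \<phi> y"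
  have undo: "?f (?g y) = inv_into D (\<lambda>x\<in>D. \<psi> (\<phi> x)) y"
    "?f (?g y) \<in> D" if "y \<in> E" for y
    using that mem by (auto simp: E inv\<psi> inv\<phi> inv)
  have "(\<lambda>x. ?f (?g (\<psi> (\<phi> x)))) ` D = (\<lambda>x. x) ` D"
    by (intro image_cong) (simp_all add: mem inv\<psi> inv\<phi>)
  then have image: "?f ` ?g ` E = D" unfolding E image_image by simp
  have "fi_inverse (fi_comp g f) = (E, D, \<lambda>y\<in>E. inv_into D (\<lambda>x\<in>D. \<psi> (\<phi> x)) y)"
    by (simp add: f' g' Let_def D_def[symmetric] E)
  also have "\<dots> = (E, ?f ` ?g ` E, \<lambda>y\<in>E. ?f (?g y))"
    unfolding image using undo(1) by (metis (no_types, lifting) restrict_ext)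
  also have "\<dots> = fi_comp (fi_inverse f) (fi_inverse g)"
    unfolding f' g' fi_inverse.simps fi_comp.simps Let_def E_def ..
  finally show ?thesis .
qed

lemma dual_fi_sel [simp]:
  "fi_obj (dual_fi F) S = dual_vs (fi_obj F S)"
  "fi_map (dual_fi F) S T f g = (\<lambda>x\<in>carrier (fi_obj F T). g (fi_map F T S (fi_inverse f) x))"
  by (simp_all add: dual_fi_def)

lemma fi_sharp_module_dual:
  assumes F: "fi_sharp_module F"
  shows "fi_sharp_module (dual_fi F)"
proof -
  note lin = fi_sharp_module_linear[OF F _ _ fi_inverse_in_hom]
  have linear: "rat_linear (fi_obj (dual_fi F) S) (fi_obj (dual_fi F) T) (fi_map (dual_fi F) S T f)"
    if ST: "finite S" "finite T" and f: "f \<in> fi_hom S T" for S T f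
  proof -
    note l = lin[OF ST(2,1) f]
    note [simp] = rat_linear_closed[OF l] rat_linear_add[OF l] rat_linear_smult[OF l]
      rat_vs_add[OF rat_linear_dom[OF l]] rat_vs_smult[OF rat_linear_dom[OF l]]
    show ?thesis
      using ST F by (intro rat_linearI)
        (auto simp: dual_vs_vectorspace fi_sharp_module_vs carrier_dual_vs intro!: restrict_ext)
  qed
  have id: "fi_map (dual_fi F) S S (fi_id S) g = g"
    if "finite S" "g \<in> carrier (fi_obj (dual_fi F) S)" for S g
    using that fi_sharp_module_id[OF F that(1)]
    by (simp add: fi_inverse_fi_id carrier_dual_vs extensional_restrict cong: restrict_cong)
  have comp: "fi_map (dual_fi F) S U (fi_comp g f) u = fi_map (dual_fi F) T U g (fi_map (dual_fi F) S T f u)"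
    if fin: "finite S" "finite T" "finite U" and f: "f \<in> fi_hom S T" and g: "g \<in> fi_hom T U" for S T U f g u
    using fi_sharp_module_comp[OF F fin(3,2,1) fi_inverse_in_hom[OF g] fi_inverse_in_hom[OF f]]
      rat_linear_closed[OF lin[OF fin(3,2) g]]
    by (auto simp: fi_inverse_comp[OF f g] intro!: restrict_ext)
  show ?thesis
    unfolding fi_sharp_module_def
  proof (intro conjI allI ballI impI)
    fix S :: "nat set" assume "finite S"
    then show "rat_vectorspace (fi_obj (dual_fi F) S)"
      unfolding dual_fi_sel by (intro dual_vs_vectorspace fi_sharp_module_vs[OF F])
  qed (rule linear id comp; assumption)+
qed

section \<open>Algebras given by generators and letter-homogeneous relators\<close>

lemma subspace_pm_on: "pm.subspace (pm_on B)"
proof (rule pm.subspaceI)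
  show "x + y \<in> pm_on B" if "x \<in> pm_on B" "y \<in> pm_on B" for x y
    using that Poly_Mapping.keys_add[of x y] by (auto simp: pm_on_def)
  show "pm_scale c x \<in> pm_on B" if "x \<in> pm_on B" for c x
    using that by (auto simp: pm_on_def in_keys_iff subset_iff)
qed (simp add: pm_on_def)

lemma pm_on_mono: "A \<subseteq> B \<Longrightarrow> x \<in> pm_on A \<Longrightarrow> x \<in> pm_on B"
  by (auto simp: pm_on_def)

lemma lin_ext_in_subspace:
  assumes "pm.subspace W" "\<And>k. k \<in> Poly_Mapping.keys v \<Longrightarrow> f k \<in> W"
  shows "lin_ext f v \<in> W"
  unfolding lin_ext_def using assms by (intro pm.subspace_sum pm.subspace_scale)

text \<open>What the Lie and the Gerstenhaber case have in common: monomials in letters which can be renamed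
  compatibly with the degree and with the operations, together with relators \<open>R S\<close> over each alphabet \<open>S\<close>.
  The decisive condition is the last one. All monomials of a relator contain the same letters, so setting
  the letters outside \<open>A\<close> to zero either kills the whole relator or does nothing to it, and renaming
  then produces a relator again. The degrees, and with them the signs in the relators, do not change.\<close>

locale renamable_monomials =
  fixes letters :: "'k \<Rightarrow> nat set" and rename :: "(nat \<Rightarrow> nat) \<Rightarrow> 'k \<Rightarrow> 'k" and dg :: "'k \<Rightarrow> nat"
    and ops :: "('k \<Rightarrow> 'k \<Rightarrow> 'k) set" and R :: "nat set \<Rightarrow> ('k \<Rightarrow>\<^sub>0 rat) set"
  assumes letters_rename: "letters (rename \<phi> t) = \<phi> ` letters t"
    and rename_rename: "rename \<psi> (rename \<phi> t) = rename (\<psi> \<circ> \<phi>) t"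
    and rename_ident: "(\<And>a. a \<in> letters t \<Longrightarrow> \<phi> a = a) \<Longrightarrow> rename \<phi> t = t"
    and rename_cong: "(\<And>a. a \<in> letters t \<Longrightarrow> \<phi> a = \<psi> a) \<Longrightarrow> rename \<phi> t = rename \<psi> t"
    and dg_rename: "dg (rename \<phi> t) = dg t"
    and letters_op: "op \<in> ops \<Longrightarrow> letters (op a b) = letters a \<union> letters b"
    and rename_op: "op \<in> ops \<Longrightarrow> rename \<phi> (op a b) = op (rename \<phi> a) (rename \<phi> b)"
    and R_act: "r \<in> R S \<Longrightarrow> A \<subseteq> S \<Longrightarrow> \<phi> ` A \<subseteq> T \<Longrightarrow>
      lin_ext (\<lambda>t. if letters t \<subseteq> A then Poly_Mapping.single (rename \<phi> t) 1 else 0) r \<in> insert 0 (R T)"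
begin

text \<open>The algebra homomorphism induced by a morphism \<open>(A, B, \<phi>)\<close> of \<open>FI#\<close>, before passing to the
  quotient.\<close>

definition act :: "nat set \<Rightarrow> (nat \<Rightarrow> nat) \<Rightarrow> ('k \<Rightarrow>\<^sub>0 rat) \<Rightarrow> ('k \<Rightarrow>\<^sub>0 rat)"
  where "act A \<phi> = lin_ext (\<lambda>t. if letters t \<subseteq> A then Poly_Mapping.single (rename \<phi> t) 1 else 0)"

definition ideal :: "nat set \<Rightarrow> ('k \<Rightarrow>\<^sub>0 rat) set"
  where "ideal S = gen_ideal ops {t. letters t \<subseteq> S} (R S)"

definition homog :: "nat \<Rightarrow> nat set \<Rightarrow> ('k \<Rightarrow>\<^sub>0 rat) set"
  where "homog l S = pm_on {t. letters t \<subseteq> S \<and> dg t = l}"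

definition piece :: "nat \<Rightarrow> ('k \<Rightarrow>\<^sub>0 rat) set fi_data"
  where "piece l = free_alg_piece letters rename dg ideal l"

lemma rename_restrict_ident: "letters t \<subseteq> A \<Longrightarrow> rename (\<lambda>x\<in>A. x) t = t"
  by (rule rename_ident) auto

lemma subspace_ideal: "pm.subspace (ideal S)"
  unfolding pm.subspace_def ideal_def by (auto intro: gen_ideal.intros)

lemma act_add: "act A \<phi> (x + y) = act A \<phi> x + act A \<phi> y"
  and act_diff: "act A \<phi> (x - y) = act A \<phi> x - act A \<phi> y"
  and act_scale: "act A \<phi> (pm_scale c x) = pm_scale c (act A \<phi> x)"
  and act_zero: "act A \<phi> 0 = 0"
  by (simp_all add: act_def lin_ext_add lin_ext_diff lin_ext_scale)

lemma act_bilin_ext: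
  assumes op: "op \<in> ops"
  shows "act A \<phi> (bilin_ext op x y) = bilin_ext op (act A \<phi> x) (act A \<phi> y)"
  unfolding act_def bilin_ext_def lin_ext_lin_ext
  by (intro lin_ext_cong) (auto simp: letters_op[OF op] rename_op[OF op] lin_ext_lin_ext intro!: lin_ext_cong)

lemma act_pm_on:
  assumes "\<phi> ` A \<subseteq> T" and "x \<in> pm_on {t. P (dg t)}"
  shows "act A \<phi> x \<in> pm_on {t. letters t \<subseteq> T \<and> P (dg t)}"
  unfolding act_def using assms
  by (intro lin_ext_in_subspace subspace_pm_on)
    (auto simp: letters_rename dg_rename pm_on_def)

text \<open>Because \<open>act A \<phi>\<close> is multiplicative, the condition on the relators passes to the ideal they
  generate; this makes the action on the quotients well defined.\<close>

lemma act_ideal: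
  assumes A: "A \<subseteq> S" and \<phi>: "\<phi> ` A \<subseteq> T" and x: "x \<in> ideal S"
  shows "act A \<phi> x \<in> ideal T"
  using x unfolding ideal_def
proof induction
  case (rel r)
  then show ?case using R_act[OF rel A \<phi>] unfolding act_def by (auto intro: gen_ideal.intros)
next
  case (left x op y)
  then show ?case
    using act_pm_on[OF \<phi>, of y "\<lambda>_. True"] by (auto simp: act_bilin_ext pm_on_def intro: gen_ideal.left)
next
  case (right x op y)
  then show ?case
    using act_pm_on[OF \<phi>, of y "\<lambda>_. True"] by (auto simp: act_bilin_ext pm_on_def intro: gen_ideal.right)
qed (auto simp: act_add act_scale act_zero intro: gen_ideal.intros)

lemma act_homog: "\<phi> ` A \<subseteq> T \<Longrightarrow> x \<in> homog l S \<Longrightarrow> act A \<phi> x \<in> homog l T"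
  unfolding homog_def
  by (rule act_pm_on[of \<phi> A T x "\<lambda>e. e = l"]) (auto intro: pm_on_mono[rotated])

lemma subspace_homog: "pm.subspace (homog l S)"
  by (simp add: homog_def subspace_pm_on)

lemma fi_obj_piece [simp]: "fi_obj (piece l) S = quot_vs (homog l S) (ideal S)"
  by (simp add: piece_def free_alg_piece_def homog_def)

lemma fi_map_piece:
  assumes "(A, B, \<phi>) \<in> fi_hom S T"
  shows "fi_map (piece l) S T (A, B, \<phi>) (pm_coset (ideal S) x) = pm_coset (ideal T) (act A \<phi> x)"
proof -
  have A: "A \<subseteq> S" "\<phi> ` A \<subseteq> T" using assms by (auto simp: fi_hom_def bij_betw_def)
  have "pm_coset (ideal T) (act A \<phi> y) = pm_coset (ideal T) (act A \<phi> x)"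
    if "y \<in> pm_coset (ideal S) x" for y
  proof -
    have "y - x \<in> ideal S" using that by (auto simp: pm_coset_def)
    then show ?thesis
      using act_ideal[OF A] by (simp add: pm_coset_eq_iff[OF subspace_ideal] act_diff[symmetric])
  qed
  moreover have "pm_coset (ideal S) x \<noteq> {}"
    using pm.subspace_0[OF subspace_ideal] by (auto simp: pm_coset_def)
  ultimately show ?thesis by (simp add: piece_def free_alg_piece_def act_def)
qed

lemma fi_sharp_module_piece: "fi_sharp_module (piece l)"
  unfolding fi_sharp_module_def
proof (intro conjI allI ballI impI)
  note quot = quot_vs_vectorspace[OF subspace_ideal subspace_homog]
  fix S :: "nat set"
  show "rat_vectorspace (fi_obj (piece l) S)" by (simp add: quot)
  {
    fix T f assume f: "f \<in> fi_hom S T"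
    obtain A B \<phi> where f': "f = (A, B, \<phi>)" by (cases f)
    have A: "\<phi> ` A \<subseteq> T" using f by (auto simp: f' fi_hom_def bij_betw_def)
    show "rat_linear (fi_obj (piece l) S) (fi_obj (piece l) T) (fi_map (piece l) S T f)"
      using f act_homog[OF A] unfolding f'
      by (intro rat_linearI)
        (auto simp: quot fi_map_piece add_quot_vs smult_quot_vs subspace_ideal act_add act_scale)
    fix U g x assume g: "g \<in> fi_hom T U" and x: "x \<in> carrier (fi_obj (piece l) S)"
    obtain A' B' \<psi> where g': "g = (A', B', \<psi>)" by (cases g)
    obtain v where v: "x = pm_coset (ideal S) v" "v \<in> homog l S" using x by auto
    define D where "D = {x \<in> A. \<phi> x \<in> A'}"
    have comp: "fi_comp g f = (D, \<psi> ` \<phi> ` D, \<lambda>x\<in>D. \<psi> (\<phi> x))" by (simp add: f' g' D_def Let_def)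
    have "fi_comp g f \<in> fi_hom S U"
      using f g unfolding comp
      by (auto simp: f' g' D_def fi_hom_def bij_betw_def inj_on_def)
    moreover have "act D (\<lambda>x\<in>D. \<psi> (\<phi> x)) v = act A' \<psi> (act A \<phi> v)"
      unfolding act_def lin_ext_lin_ext
      by (intro lin_ext_cong)
        (auto simp: letters_rename rename_rename D_def subset_iff intro!: rename_cong arg_cong2[of _ _ _ _ Poly_Mapping.single])
    ultimately show "fi_map (piece l) S U (fi_comp g f) x = fi_map (piece l) T U g (fi_map (piece l) S T f x)"
      using f g unfolding v comp by (simp add: f' g' fi_map_piece)
  }
  fix x assume "x \<in> carrier (fi_obj (piece l) S)"
  then obtain v where v: "x = pm_coset (ideal S) v" "v \<in> homog l S" by auto
  have "act S (\<lambda>x\<in>S. x) v = lin_ext (\<lambda>t. Poly_Mapping.single t 1) v"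
    unfolding act_def using v(2)
    by (intro lin_ext_cong) (auto simp: homog_def pm_on_def rename_restrict_ident)
  then show "fi_map (piece l) S S (fi_id S) x = x"
    using fi_id_in_hom[of S S S] by (simp add: v fi_id_def fi_map_piece lin_ext_basis)
qed

text \<open>The part of a vector supported on the monomials whose set of letters is exactly \<open>A\<close>.\<close>

definition exact_part :: "nat set \<Rightarrow> ('k \<Rightarrow>\<^sub>0 rat) \<Rightarrow> ('k \<Rightarrow>\<^sub>0 rat)"
  where "exact_part A = lin_ext (\<lambda>t. if letters t = A then Poly_Mapping.single t 1 else 0)"

lemma lookup_exact_part: "Poly_Mapping.lookup (exact_part A x) t = (if letters t = A then Poly_Mapping.lookup x t else 0)"
proof -
  have "Poly_Mapping.lookup (if letters k = A then Poly_Mapping.single k (1::rat) else 0) t =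
      (if k = t then if letters t = A then 1 else 0 else 0)" for k
    by (simp add: lookup_single)
  then show ?thesis
    by (simp add: exact_part_def lin_ext_def lookup_sum in_keys_iff if_distrib[of "(*) _"] cong: if_cong)
qed

lemma act_eq_sum_exact_part:
  assumes "finite A"
  shows "act A (\<lambda>x\<in>A. x) x = (\<Sum>C\<in>Pow A. exact_part C x)"
proof -
  have "act A (\<lambda>x\<in>A. x) x = lin_ext (\<lambda>t. if letters t \<subseteq> A then Poly_Mapping.single t 1 else 0) x"
    unfolding act_def by (intro lin_ext_cong) (simp add: rename_restrict_ident)
  also have "\<dots> = (\<Sum>C\<in>Pow A. exact_part C x)"
  proof -
    have "(if letters t \<subseteq> A then Poly_Mapping.single t (1::rat) else 0) =
        (\<Sum>C\<in>Pow A. if letters t = C then Poly_Mapping.single t 1 else 0)" for t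
      using assms by simp
    then show ?thesis
      unfolding exact_part_def lin_ext_def by (subst sum.swap) (simp add: pm.scale_sum_right)
  qed
  finally show ?thesis .
qed

lemma in_ideal_if_exact_parts_in_ideal:
  assumes "\<And>A. A \<in> letters ` Poly_Mapping.keys x \<Longrightarrow> exact_part A x \<in> ideal S"
  shows "x \<in> ideal S"
proof -
  have "x = (\<Sum>A\<in>letters ` Poly_Mapping.keys x. exact_part A x)"
    by (rule poly_mapping_eqI) (auto simp: lookup_sum lookup_exact_part in_keys_iff)
  also have "\<dots> \<in> ideal S" by (intro pm.subspace_sum[OF subspace_ideal] assms)
  finally show ?thesis .
qed

lemma fi_map_piece_fi_id_eq_zero_iff:
  assumes "A \<subseteq> S"
  shows "fi_map (piece l) S S (fi_id A) (pm_coset (ideal S) x) = \<zero>\<^bsub>fi_obj (piece l) S\<^esub> \<longleftrightarrow>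
    act A (\<lambda>x\<in>A. x) x \<in> ideal S"
  using fi_id_in_hom[OF assms assms] pm_coset_eq_iff[OF subspace_ideal, of S _ 0]
  by (simp add: fi_id_def fi_map_piece pm_coset_zero)

text \<open>The idempotent for \<open>A\<close> is the sum of the exact parts over all \<open>C \<subseteq> A\<close>. If these idempotents send
  \<open>x\<close> into the ideal for all small \<open>A\<close>, then by induction along inclusion so do all small exact parts; as
  the monomials of degree \<open>l\<close> have few letters, these are all the exact parts of \<open>x\<close>.\<close>

lemma piece_detected_by_subsets:
  assumes k: "\<And>t. dg t = l \<Longrightarrow> card (letters t) \<le> k"
  shows "detected_by_subsets k (piece l)"
  unfolding detected_by_subsets_def
proof (intro allI ballI impI)
  fix S :: "nat set" and X
  assume S: "finite S" and X: "X \<in> carrier (fi_obj (piece l) S)"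
    and zero: "\<forall>A\<subseteq>S. card A \<le> k \<longrightarrow> fi_map (piece l) S S (fi_id A) X = \<zero>\<^bsub>fi_obj (piece l) S\<^esub>"
  obtain x where x: "X = pm_coset (ideal S) x" "x \<in> homog l S" using X by auto
  have comp: "exact_part A x \<in> ideal S" if "A \<subseteq> S" "card A \<le> k" for A
    using finite_subset[OF that(1) S] that
  proof (induction A rule: finite_psubset_induct)
    case (psubset A)
    have act: "act A (\<lambda>x\<in>A. x) x \<in> ideal S"
      using zero psubset.prems fi_map_piece_fi_id_eq_zero_iff by (simp add: x)
    have "act A (\<lambda>x\<in>A. x) x = exact_part A x + (\<Sum>C\<in>Pow A - {A}. exact_part C x)"
      using psubset.hyps by (simp add: act_eq_sum_exact_part sum.remove[of "Pow A" A])
    moreover have "(\<Sum>C\<in>Pow A - {A}. exact_part C x) \<in> ideal S"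
    proof (intro pm.subspace_sum[OF subspace_ideal])
      fix C assume "C \<in> Pow A - {A}"
      then show "exact_part C x \<in> ideal S"
        using psubset.prems card_mono[OF psubset.hyps, of C] by (intro psubset.IH) auto
    qed
    ultimately show ?case
      using pm.subspace_diff[OF subspace_ideal act] by (metis add_diff_cancel_right')
  qed
  have "x \<in> ideal S"
  proof (rule in_ideal_if_exact_parts_in_ideal)
    fix A assume "A \<in> letters ` Poly_Mapping.keys x"
    then show "exact_part A x \<in> ideal S"
      using x(2) k by (intro comp) (auto simp: homog_def pm_on_def)
  qed
  then show "X = \<zero>\<^bsub>fi_obj (piece l) S\<^esub>"
    using pm_coset_eq_iff[OF subspace_ideal, of S x 0] by (simp add: x pm_coset_zero)
qed

text \<open>A monomial is fixed by the idempotent of its own set of letters, which is small. So a functional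
  that vanishes on the images of the small idempotents vanishes on every monomial.\<close>

lemma dual_piece_detected_by_subsets:
  assumes k: "\<And>t. dg t = l \<Longrightarrow> card (letters t) \<le> k"
  shows "detected_by_subsets k (dual_fi (piece l))"
  unfolding detected_by_subsets_def
proof (intro allI ballI impI)
  fix S :: "nat set" and g
  let ?V = "fi_obj (piece l) S"
  assume S: "finite S" and g: "g \<in> carrier (fi_obj (dual_fi (piece l)) S)"
    and zero: "\<forall>A\<subseteq>S. card A \<le> k \<longrightarrow>
      fi_map (dual_fi (piece l)) S S (fi_id A) g = \<zero>\<^bsub>fi_obj (dual_fi (piece l)) S\<^esub>"
  have g: "g \<in> extensional (carrier ?V)"
    "\<And>x y. x \<in> homog l S \<Longrightarrow> y \<in> homog l S \<Longrightarrow>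
      g (pm_coset (ideal S) (x + y)) = g (pm_coset (ideal S) x) + g (pm_coset (ideal S) y)"
    "\<And>c x. x \<in> homog l S \<Longrightarrow> g (pm_coset (ideal S) (pm_scale c x)) = c * g (pm_coset (ideal S) x)"
    using g by (auto simp: carrier_dual_vs add_quot_vs smult_quot_vs subspace_ideal)
  have single: "g (pm_coset (ideal S) (Poly_Mapping.single t 1)) = 0"
    if t: "letters t \<subseteq> S" "dg t = l" for t
  proof -
    let ?t = "Poly_Mapping.single t (1::rat)"
    have V: "pm_coset (ideal S) ?t \<in> carrier ?V" using t by (simp add: homog_def pm_on_def)
    have "fi_map (dual_fi (piece l)) S S (fi_id (letters t)) g = \<zero>\<^bsub>fi_obj (dual_fi (piece l)) S\<^esub>"
      using zero t k by blast
    then have "g (fi_map (piece l) S S (fi_id (letters t)) (pm_coset (ideal S) ?t)) = 0"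
      using V by (auto simp: fi_inverse_fi_id dest!: fun_cong[of _ _ "pm_coset (ideal S) ?t"] split: if_splits)
    moreover have "act (letters t) (\<lambda>x\<in>letters t. x) ?t = ?t"
      by (simp add: act_def rename_ident)
    ultimately show ?thesis
      using fi_id_in_hom[OF t(1) t(1)] by (simp add: fi_id_def fi_map_piece)
  qed
  have "g (pm_coset (ideal S) x) = 0" if x: "x \<in> homog l S" for x
  proof -
    let ?s = "\<lambda>t. pm_scale (Poly_Mapping.lookup x t) (Poly_Mapping.single t (1::rat))"
    have mono: "Poly_Mapping.single t 1 \<in> homog l S" "letters t \<subseteq> S" "dg t = l"
      if "t \<in> Poly_Mapping.keys x" for t
      using x that by (auto simp: homog_def pm_on_def)
    have "(\<Sum>t\<in>K. ?s t) \<in> homog l S \<and> g (pm_coset (ideal S) (\<Sum>t\<in>K. ?s t)) = 0"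
      if "finite K" "K \<subseteq> Poly_Mapping.keys x" for K
      using that
    proof (induction K)
      case empty
      show ?case using g(3)[of 0 0] pm.subspace_0[OF subspace_homog] by simp
    next
      case (insert t K)
      have "?s t \<in> homog l S" using insert.prems mono by (intro pm.subspace_scale subspace_homog) auto
      moreover have "g (pm_coset (ideal S) (?s t)) = 0"
        using insert.prems by (subst g(3)) (simp_all add: mono single)
      ultimately show ?case
        using insert pm.subspace_add[OF subspace_homog] g(2)[of "?s t" "\<Sum>t\<in>K. ?s t"] by simp
    qed
    from this[of "Poly_Mapping.keys x"] show ?thesis
      using lin_ext_basis[of x] by (simp add: lin_ext_def)
  qed
  then show "g = \<zero>\<^bsub>fi_obj (dual_fi (piece l)) S\<^esub>"
    using g(1) by (intro extensionalityI[of _ "carrier ?V"]) auto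
qed

end

section \<open>Lie and Gerstenhaber algebras\<close>

text \<open>Each occurrence of a generator contributes \<open>d\<close> to the degree of a monomial, and the operations
  contribute nothing negative.\<close>

lemma lie_letters_le_degree: "d * card (set_lie_term t) \<le> ldeg d m t"
proof (induction t)
  case (LBr a b)
  have "d * card (set_lie_term (LBr a b)) \<le> d * (card (set_lie_term a) + card (set_lie_term b))"
    by (simp add: card_Un_le)
  with LBr show ?case by (simp add: distrib_left)
qed simp

lemma gerst_letters_le_degree: "d * card (set_gerst_term t) \<le> gdeg d m t"
proof (induction t)
  case (GProd a b)
  have "d * card (set_gerst_term (GProd a b)) \<le> d * (card (set_gerst_term a) + card (set_gerst_term b))"
    by (simp add: card_Un_le)
  with GProd show ?case by (simp add: distrib_left)
next
  case (GBr a b)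
  have "d * card (set_gerst_term (GBr a b)) \<le> d * (card (set_gerst_term a) + card (set_gerst_term b))"
    by (simp add: card_Un_le)
  with GBr show ?case by (simp add: distrib_left)
qed simp_all

lemma ldeg_rename [simp]: "ldeg d m (map_lie_term \<phi> t) = ldeg d m t"
  by (induction t) simp_all

lemma gdeg_rename [simp]: "gdeg d m (map_gerst_term \<phi> t) = gdeg d m t"
  by (induction t) simp_all

lemma set_map_lie_term_subset: "\<phi> ` A \<subseteq> T \<Longrightarrow> set_lie_term t \<subseteq> A \<Longrightarrow> set_lie_term (map_lie_term \<phi> t) \<subseteq> T"
  by (auto simp: lie_term.set_map)

lemma set_map_gerst_term_subset: "\<phi> ` A \<subseteq> T \<Longrightarrow> set_gerst_term t \<subseteq> A \<Longrightarrow> set_gerst_term (map_gerst_term \<phi> t) \<subseteq> T"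
  by (auto simp: gerst_term.set_map)

interpretation lie: renamable_monomials set_lie_term map_lie_term "ldeg d m" "{LBr}" "lie_relators d m"
  for d m
proof (unfold_locales, goal_cases)
  case (8 r S A \<phi> T)
  note s = set_map_lie_term_subset[OF 8(3)]
  from 8(1) show ?case
    unfolding lie_relators_def Let_def
  proof (elim UnE CollectE exE conjE, goal_cases)
    case (1 a b)
    then show ?case
      using s[of a] s[of b] by (simp add: lin_ext_add lin_ext_diff) (metis ldeg_rename)
  next
    case (2 a b c)
    then show ?case
      using s[of a] s[of b] s[of c] by (simp add: lin_ext_add lin_ext_diff) (metis ldeg_rename)
  qed
qed (auto simp: lie_term.set_map lie_term.map_comp lie_term.map_ident_strong intro: lie_term.map_cong)

interpretation gerst: renamable_monomials set_gerst_term map_gerst_term "gdeg d m" "{GProd, GBr}"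
    "gerst_relators d m"
  for d m
proof (unfold_locales, goal_cases)
  case (8 r S A \<phi> T)
  note s = set_map_gerst_term_subset[OF 8(3)]
  from 8(1) show ?case
    unfolding gerst_relators_def Let_def
  proof (elim UnE CollectE exE conjE, goal_cases)
    case (1 a)
    then show ?case
      using s[of a] by (simp add: lin_ext_diff) metis
  next
    case (2 a b c)
    then show ?case
      using s[of a] s[of b] s[of c] by (simp add: lin_ext_diff) metis
  next
    case (3 a b)
    then show ?case
      using s[of a] s[of b] by (simp add: lin_ext_diff) (metis gdeg_rename)
  next
    case (4 a b)
    then show ?case
      using s[of a] s[of b] by (simp add: lin_ext_add) (metis gdeg_rename)
  next
    case (5 a b c)
    then show ?case
      using s[of a] s[of b] s[of c] by (simp add: lin_ext_diff) (metis gdeg_rename)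
  next
    case (6 a b c)
    then show ?case
      using s[of a] s[of b] s[of c] by (simp add: lin_ext_diff) (metis gdeg_rename)
  qed
qed (auto simp: gerst_term.set_map gerst_term.map_comp gerst_term.map_ident_strong intro: gerst_term.map_cong)

lemma lie_fi_eq_piece: "lie_fi d m l = lie.piece d m l"
proof -
  have "lie.ideal d m = lie_ideal d m" by (intro ext) (simp add: lie.ideal_def lie_ideal_def)
  then show ?thesis by (simp add: lie_fi_def lie.piece_def)
qed

lemma gerst_fi_eq_dual_piece: "gerst_fi d m l = dual_fi (gerst.piece d m l)"
proof -
  have "gerst.ideal d m = gerst_ideal d m" by (intro ext) (simp add: gerst.ideal_def gerst_ideal_def)
  then show ?thesis by (simp add: gerst_fi_def gerst.piece_def)
qed

text \<open>With \<open>k\<close> letters the degree \<open>l\<close> is at least \<open>d k\<close>, and \<open>(m + 2) d = m d + 2 d \<ge> m + d\<close>; so the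
  number of letters is already within the asserted slope.\<close>

lemma div_le_slope:
  fixes d m l :: nat
  assumes "d \<ge> 1"
  shows "real (l div d) \<le> (real m + 2) / (real m + real d) * real l"
proof -
  let ?k = "l div d"
  have "real ?k * (real m + real d) \<le> real ?k * ((real m + 2) * real d)"
  proof (intro mult_left_mono)
    have "real m * 1 \<le> real m * real d" using assms by (intro mult_left_mono) auto
    then show "real m + real d \<le> (real m + 2) * real d" by (simp add: algebra_simps)
  qed simp
  also have "\<dots> = (real m + 2) * real (?k * d)" by simp
  also have "\<dots> \<le> (real m + 2) * real l"
    by (intro mult_left_mono) (simp_all add: of_nat_mono del: of_nat_mult)
  finally show ?thesis using assms by (simp add: field_simps)
qed

theorem corollary5p21:
  fixes d m l :: nat
  assumes "d \<ge> 2" and "m \<ge> 1"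
  shows "(fi_sharp_module (gerst_fi d m l) \<and>
          weight_le (gerst_fi d m l) ((real m + 2) / (real m + real d) * real l)) \<and>
         (fi_sharp_module (lie_fi d m l) \<and>
          weight_le (lie_fi d m l) ((real m + 2) / (real m + real d) * real l))"
proof -
  have d: "d \<ge> 1" using assms by simp
  note slope = div_le_slope[OF d, of l m]
  have "card (set_lie_term t) \<le> l div d" if "ldeg d m t = l" for t :: "nat lie_term"
    using lie_letters_le_degree[of d t m] that d by (simp add: less_eq_div_iff_mult_less_eq mult.commute)
  note lie = lie.piece_detected_by_subsets[OF this]
  have "card (set_gerst_term t) \<le> l div d" if "gdeg d m t = l" for t :: "nat gerst_term"
    using gerst_letters_le_degree[of d t m] that d by (simp add: less_eq_div_iff_mult_less_eq mult.commute)
  note gerst = gerst.dual_piece_detected_by_subsets[OF this]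
  have "fi_sharp_module (lie_fi d m l)" "fi_sharp_module (gerst_fi d m l)"
    by (simp_all add: lie_fi_eq_piece lie.fi_sharp_module_piece gerst_fi_eq_dual_piece
        fi_sharp_module_dual gerst.fi_sharp_module_piece)
  with lie gerst slope show ?thesis
    by (auto simp: lie_fi_eq_piece gerst_fi_eq_dual_piece intro!: weight_le_if_detected_by_subsets)
qed

end
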